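(* There is a monotone Schauder basis $\mathcal{X}=(x_n)_{n=1}^\infty$ of a Banach space $X$ that is lower unconditional for constant coefficients (LUCC) and super-democratic, hence lattice partially unconditional (LPU), but is not quasi-greedy for largest coefficients (QGLC). Moreover, given $1\le p<\infty$ we can choose $\mathcal{X}$ to satisfy $\varphi_u(m)\approx m^{1/p}$ for $m\in\mathbb{N}$, i.e. there is a constant $C\ge1$ with $C^{-1}m^{1/p}\le\varphi_u(m)\le Cm^{1/p}$ for all $m\in\mathbb{N}$.
   Context: $\mathbb{N}$ is the set of positive integers; the scalar field $\mathbb{F}$ is $\mathbb{R}$ or $\mathbb{C}$; $\mathbb{E}=\{\lambda\in\mathbb{F}:|\lambda|=1\}$. A basis of a Banach space $X$ is a norm-bounded sequence $(x_n)_{n=1}^\infty$ in $X$ whose linear span is dense in $X$ and for which there is a norm-bounded sequence $(x_n^* )_{n=1}^\infty$ in $X^*$ with $x_n^*(x_k)=\delta_{n,k}$. A Schauder basis of $X$ is a sequence $(x_n)$ such that every $f\in X$ has a unique norm-convergent expansion $f=\sum_na_nx_n$; the Schauder bases considered are also bases in the previous sense. For finite $A\subset\mathbb{N}$ and $\varepsilon\in\mathbb{E}^A$, $S_A(f)=\sum_{n\in A}x_n^*(f)x_n$ and $\mathbf{1}_{\varepsilon,A}=\sum_{n\in A}\varepsilon_nx_n$. A Schauder basis is monotone if $\sup_m\|S_{\{1,\dots,m\}}\|=1$. A finite set $A\subset\mathbb{N}$ is a greedy set of $f$ if $|x_n^*(f)|\ge|x_k^*(f)|$ for all $n\in A$,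 $k\in\mathbb{N}\setminus A$. For nonempty finite $A$, $\mathrm{osc}(f,A)=\max_{n\in A}|x_n^*(f)|/\min_{n\in A}|x_n^*(f)|$, with $0/0=1$ and $a/0=\infty$ for $a>0$. The basis is QGLC if there is $C$ with $\|S_A(f)\|\le C\|f\|$ for all $f\in X$ and all greedy sets $A$ of $f$ with $\mathrm{osc}(f,A)=1$; equivalently, $\|\mathbf{1}_{\varepsilon,A}\|\le C\|\mathbf{1}_{\varepsilon,A}+f\|$ for all finite $A$, all $\varepsilon\in\mathbb{E}^A$, and all $f\in X$ with $\sup_n|x_n^*(f)|\le1$ and $x_n^*(f)=0$ for $n\in A$. Consider the inequality $( * )$: $\|\sum_{n\in A}b_nx_n\|\le C\|\sum_{n\in A}a_nx_n\|$. The basis is LPU if there is $C$ such that $( * )$ holds for all finite $A$ and all scalar families with $\sup_{n\in A}|b_n|\le\inf_{n\in A}|a_n|$. It is LUCC if there is $C$ such that $( * )$ holds for all finite $A$ and all scalar families such that, for every $n\in A$, $|b_n|=1$ and $a_n/b_n$ is a real number in $[1,\infty)$. The basis is super-democratic if there is $C$ such that $\|\mathbf{1}_{\varepsilon,A}\|\le C\|\mathbf{1}_{\delta,B}\|$ for all finite $A,B\subset\mathbb{N}$ with $|A|\le|B|$, all $\varepsilon\in\mathbb{E}^A$ and all $\delta\in\mathbb{E}^B$. The fundamental function is $\varphi_u(m)=\sup\{\|\mathbf{1}_{\varepsilon,A}\|:|A|\le m,\ \varepsilon\in\mathbb{E}^A\}$. *)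

theory Defs
  imports "HOL-Analysis.Analysis" "HOL-Library.Function_Algebras"
begin

text \<open>
  A statement that some Banach space exists cannot quantify over types. A Banach space is therefore
  a linear subspace \<open>X\<close> of an ambient vector space, with its own norm \<open>nrm\<close>; only the values of
  \<open>nrm\<close> on \<open>X\<close> matter. The scalar field \<open>'f\<close> is to be \<open>real\<close> or \<open>complex\<close>.
\<close>

locale normed_space_on = vector_space scale
  for scale :: "'f::real_normed_field \<Rightarrow> 'v::ab_group_add \<Rightarrow> 'v"  (infixr \<open>*s\<close> 75) +
  fixes X :: "'v set" and nrm :: "'v \<Rightarrow> real"
  assumes subspace_X: "subspace X"
    and nrm_nonneg: "f \<in> X \<Longrightarrow> 0 \<le> nrm f"
    and nrm_eq_0_iff: "f \<in> X \<Longrightarrow> nrm f = 0 \<longleftrightarrow> f = 0"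
    and nrm_scale: "f \<in> X \<Longrightarrow> nrm (c *s f) = norm c * nrm f"
    and nrm_triangle: "f \<in> X \<Longrightarrow> g \<in> X \<Longrightarrow> nrm (f + g) \<le> nrm f + nrm g"

locale banach_space_on = normed_space_on scale X nrm
  for scale :: "'f::real_normed_field \<Rightarrow> 'v::ab_group_add \<Rightarrow> 'v"  (infixr \<open>*s\<close> 75) and X nrm +
  assumes complete_X:
    "(\<And>n. u n \<in> X) \<Longrightarrow> (\<forall>e>0. \<exists>N. \<forall>m\<ge>N. \<forall>n\<ge>N. nrm (u m - u n) < e) \<Longrightarrow>
       \<exists>l\<in>X. (\<lambda>n. nrm (u n - l)) \<longlonglongrightarrow> 0"
begin

definition operator_norm :: "('v \<Rightarrow> 'v) \<Rightarrow> ennreal" where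
  "operator_norm T = (SUP f\<in>{f \<in> X. nrm f \<le> 1}. ennreal (nrm (T f)))"

definition schauder_basis :: "(nat \<Rightarrow> 'v) \<Rightarrow> bool" where
  "schauder_basis x \<longleftrightarrow> (\<forall>n. x n \<in> X) \<and>
     (\<forall>f\<in>X. \<exists>!a. (\<lambda>m. nrm ((\<Sum>n<m. a n *s x n) - f)) \<longlonglongrightarrow> 0)"

end

text \<open>
  Indices start at \<open>0\<close>, so that \<open>{..<m}\<close> plays the role of \<open>{1, \<dots>, m}\<close>. The coordinate functionals
  \<open>xs\<close> are a parameter of the locale; on \<open>X\<close> they are determined by \<open>x\<close>, by density of the span.
\<close>

locale banach_basis = banach_space_on scale X nrm
  for scale :: "'f::real_normed_field \<Rightarrow> 'v::ab_group_add \<Rightarrow> 'v"  (infixr \<open>*s\<close> 75) and X nrm +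
  fixes x :: "nat \<Rightarrow> 'v" and xs :: "nat \<Rightarrow> 'v \<Rightarrow> 'f"
  assumes x_in: "x n \<in> X"
    and x_bounded: "\<exists>C. \<forall>n. nrm (x n) \<le> C"
    and span_dense: "f \<in> X \<Longrightarrow> 0 < e \<Longrightarrow> \<exists>g\<in>span (range x). nrm (f - g) < e"
    and xs_add: "f \<in> X \<Longrightarrow> g \<in> X \<Longrightarrow> xs n (f + g) = xs n f + xs n g"
    and xs_scale: "f \<in> X \<Longrightarrow> xs n (c *s f) = c * xs n f"
    and xs_bounded: "\<exists>C. \<forall>n. \<forall>f\<in>X. norm (xs n f) \<le> C * nrm f"
    and biorthogonal: "xs n (x k) = (if n = k then 1 else 0)"
begin

definition S :: "nat set \<Rightarrow> 'v \<Rightarrow> 'v" where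
  "S A f = (\<Sum>n\<in>A. xs n f *s x n)"

definition signed_sum :: "(nat \<Rightarrow> 'f) \<Rightarrow> nat set \<Rightarrow> 'v" where
  "signed_sum \<epsilon> A = (\<Sum>n\<in>A. \<epsilon> n *s x n)"

definition monotone_basis :: bool where
  "monotone_basis \<longleftrightarrow> (SUP m\<in>{1..}. operator_norm (S {..<m})) = 1"

definition greedy_set :: "'v \<Rightarrow> nat set \<Rightarrow> bool" where
  "greedy_set f A \<longleftrightarrow> finite A \<and> (\<forall>n\<in>A. \<forall>k\<in>-A. norm (xs k f) \<le> norm (xs n f))"

definition osc :: "'v \<Rightarrow> nat set \<Rightarrow> ereal" where
  "osc f A = (let M = (MAX n\<in>A. norm (xs n f)); m = (MIN n\<in>A. norm (xs n f)) in
     if m = 0 then (if M = 0 then 1 else \<infinity>) else ereal (M / m))"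

definition QGLC :: bool where
  "QGLC \<longleftrightarrow> (\<exists>C. \<forall>f\<in>X. \<forall>A. A \<noteq> {} \<longrightarrow> greedy_set f A \<longrightarrow> osc f A = 1 \<longrightarrow>
     nrm (S A f) \<le> C * nrm f)"

text \<open>For empty \<open>A\<close> the inequality below is \<open>0 \<le> 0\<close>, so only nonempty \<open>A\<close> are considered.\<close>

definition LPU :: bool where
  "LPU \<longleftrightarrow> (\<exists>C. \<forall>A a b. finite A \<longrightarrow> A \<noteq> {} \<longrightarrow>
     (SUP n\<in>A. norm (b n)) \<le> (INF n\<in>A. norm (a n)) \<longrightarrow>
     nrm (\<Sum>n\<in>A. b n *s x n) \<le> C * nrm (\<Sum>n\<in>A. a n *s x n))"

definition LUCC :: bool where
  "LUCC \<longleftrightarrow> (\<exists>C. \<forall>A a b. finite A \<longrightarrow>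
     (\<forall>n\<in>A. norm (b n) = 1 \<and> (\<exists>t::real. 1 \<le> t \<and> a n / b n = of_real t)) \<longrightarrow>
     nrm (\<Sum>n\<in>A. b n *s x n) \<le> C * nrm (\<Sum>n\<in>A. a n *s x n))"

definition super_democratic :: bool where
  "super_democratic \<longleftrightarrow> (\<exists>C. \<forall>A B \<epsilon> \<delta>. finite A \<longrightarrow> finite B \<longrightarrow> card A \<le> card B \<longrightarrow>
     (\<forall>n\<in>A. norm (\<epsilon> n) = 1) \<longrightarrow> (\<forall>n\<in>B. norm (\<delta> n) = 1) \<longrightarrow>
     nrm (signed_sum \<epsilon> A) \<le> C * nrm (signed_sum \<delta> B))"

definition fundamental_function :: "nat \<Rightarrow> real" where
  "fundamental_function m =
     Sup {nrm (signed_sum \<epsilon> A) | A \<epsilon>. finite A \<and> card A \<le> m \<and> (\<forall>n\<in>A. norm (\<epsilon> n) = 1)}"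

text \<open>The supremum is one of a bounded set, hence not a junk value of the real \<open>Sup\<close>.\<close>

lemma fundamental_function_bdd_above:
  "bdd_above {nrm (signed_sum \<epsilon> A) | A \<epsilon>. finite A \<and> card A \<le> m \<and> (\<forall>n\<in>A. norm (\<epsilon> n) = 1)}"
proof -
  obtain C where C: "\<And>n. nrm (x n) \<le> C" using x_bounded by blast
  have C0: "0 \<le> C" using C[of 0] nrm_nonneg[OF x_in[of 0]] by linarith
  have nrm0: "nrm 0 = 0" using nrm_eq_0_iff subspace_0[OF subspace_X] by blast
  have sum_bd: "nrm (signed_sum \<epsilon> A) \<le> real (card A) * C"
    if "finite A" "\<forall>n\<in>A. norm (\<epsilon> n) = 1" for A and \<epsilon> :: "nat \<Rightarrow> 'f"
    using that
  proof (induction A)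
    case empty
    then show ?case by (simp add: signed_sum_def nrm0)
  next
    case (insert k A)
    have "(\<Sum>n\<in>A. \<epsilon> n *s x n) \<in> X"
      by (intro subspace_sum subspace_X subspace_scale x_in)
    moreover have "\<epsilon> k *s x k \<in> X" by (intro subspace_X subspace_scale x_in)
    ultimately have "nrm (signed_sum \<epsilon> (insert k A)) \<le> nrm (\<epsilon> k *s x k) + nrm (signed_sum \<epsilon> A)"
      using insert nrm_triangle by (simp add: signed_sum_def)
    also have "nrm (\<epsilon> k *s x k) \<le> C" using insert C x_in by (simp add: nrm_scale)
    finally show ?case using insert by (simp add: algebra_simps)
  qed
  show ?thesis
  proof (rule bdd_aboveI[of _ "real m * C"], clarify)
    fix A and \<epsilon> :: "nat \<Rightarrow> 'f"
    assume "finite A" "card A \<le> m" "\<forall>n\<in>A. norm (\<epsilon> n) = 1"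
    then show "nrm (signed_sum \<epsilon> A) \<le> real m * C"
      using sum_bd[of A \<epsilon>] C0 by (meson mult_right_mono of_nat_le_iff order_trans)
  qed
qed

end

end

theory Submission
  imports Defs "HOL-Library.Discrete_Functions"
begin

text \<open>
  Put \<open>t = 1 / p\<close>. The indices are cut into the dyadic blocks \<open>[2 ^ n, 2 ^ (n + 1))\<close>; the first
  coordinate of a block is compared with the \<open>K = 2 ^ n - 1\<close> others through the defect
  \<open>f (2 ^ n) - K powr (t - 1) * (\<Sum>i. f i)\<close>. The norm is the larger of a weak \<open>\<ell>\<^sub>p\<close> norm of the
  sequence of defects and of a Schreier-type version of that norm on the other coordinates, made
  monotone by a supremum over initial segments. Each seminorm is at most \<open>4 * card A powr t\<close> on
  vectors supported on \<open>A\<close> with coefficients of modulus at most 1. If the coefficients on \<open>A\<close> have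
  modulus at least 1, then the norm is at least \<open>card A powr t / 6\<close>: a cancellation in a defect costs
  at least one coordinate inside the block, and these are seen by the Schreier part. Coefficients
  \<open>1\<close> at \<open>2 ^ n\<close> and \<open>K powr - t\<close> on the rest of the block for \<open>1 \<le> n \<le> N\<close> cancel all defects,
  and the Schreier part of this vector is bounded independently of \<open>N\<close>, so that QGLC fails.
\<close>

section \<open>Sequence spaces normed by a family of seminorms\<close>

definition trunc :: "nat \<Rightarrow> (nat \<Rightarrow> 'f::zero) \<Rightarrow> nat \<Rightarrow> 'f" where
  "trunc m f = (\<lambda>i. if i < m then f i else 0)"

definition pw_scale :: "'f::times \<Rightarrow> (nat \<Rightarrow> 'f) \<Rightarrow> nat \<Rightarrow> 'f" where
  "pw_scale c f = (\<lambda>i. c * f i)"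

definition unit_seq :: "nat \<Rightarrow> nat \<Rightarrow> 'f::zero_neq_one" where
  "unit_seq n = (\<lambda>i. if i = n then 1 else 0)"

definition restr :: "nat set \<Rightarrow> (nat \<Rightarrow> 'f::zero) \<Rightarrow> nat \<Rightarrow> 'f" where
  "restr A f = (\<lambda>i. if i \<in> A then f i else 0)"

lemma trunc_trunc: "trunc m (trunc k f) = trunc (min m k) f"
  by (auto simp: trunc_def)

lemma trunc_diff: "trunc m (f - g) = trunc m f - trunc m (g :: nat \<Rightarrow> 'f::ab_group_add)"
  by (auto simp: trunc_def fun_eq_iff)

lemma trunc_eq_restr: "trunc m f = restr {..<m} f"
  by (auto simp: trunc_def restr_def)

lemma sum_fun_apply: "(\<Sum>n\<in>A. h n) i = (\<Sum>n\<in>A. h n i :: 'f::comm_monoid_add)"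
  by (induction A rule: infinite_finite_induct) auto

lemma sum_unit_seq:
  assumes "finite A"
  shows "(\<Sum>n\<in>A. pw_scale (b n) (unit_seq n)) = restr A (b :: nat \<Rightarrow> 'f::semiring_1)"
  using assms
  by (auto simp: fun_eq_iff sum_fun_apply pw_scale_def unit_seq_def restr_def
      if_distrib[of "\<lambda>z. _ * z"] cong: if_cong)

lemma vector_space_pw_scale: "vector_space (pw_scale :: 'f::field \<Rightarrow> _)"
  by unfold_locales (auto simp: pw_scale_def fun_eq_iff algebra_simps)

text \<open>\<open>Q_tendsto\<close> lets a bound valid for all seminorms pass to pointwise limits,
  which gives completeness. \<open>Q_trunc\<close> makes truncations contractions, which gives
  monotonicity. \<open>Q_coord\<close> makes the supremum definite and the coordinate functionals
  bounded.\<close>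

locale seminorm_family =
  fixes Q :: "((nat \<Rightarrow> 'f::{real_normed_field,banach}) \<Rightarrow> real) set"
  assumes Q_nonneg: "q \<in> Q \<Longrightarrow> 0 \<le> q f"
    and Q_scale: "q \<in> Q \<Longrightarrow> q (pw_scale c f) = norm c * q f"
    and Q_add: "q \<in> Q \<Longrightarrow> q (f + g) \<le> q f + q g"
    and Q_tendsto: "q \<in> Q \<Longrightarrow> (\<And>i. (\<lambda>k. u k i) \<longlonglongrightarrow> l i) \<Longrightarrow> (\<lambda>k. q (u k)) \<longlonglongrightarrow> q l"
    and Q_trunc: "q \<in> Q \<Longrightarrow> (\<lambda>f. q (trunc m f)) \<in> Q"
    and Q_unit: "\<exists>C. \<forall>q\<in>Q. \<forall>n. q (unit_seq n) \<le> C"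
    and Q_coord: "\<exists>q\<in>Q. \<forall>f. norm (f n) \<le> q f"
begin

text \<open>The real supremum of an unbounded set is an unspecified value, so finiteness of the norm
  is carried as a separate predicate.\<close>

definition bdd :: "(nat \<Rightarrow> 'f) \<Rightarrow> bool" where
  "bdd f \<longleftrightarrow> bdd_above ((\<lambda>q. q f) ` Q)"

definition nrm :: "(nat \<Rightarrow> 'f) \<Rightarrow> real" where
  "nrm f = (SUP q\<in>Q. q f)"

text \<open>This is the closure of the finitely supported sequences, expressed through tails. In the
  space of all bounded sequences the unit vectors need not have dense span.\<close>

definition X :: "(nat \<Rightarrow> 'f) set" where
  "X = {f. bdd f \<and> (\<lambda>m. nrm (f - trunc m f)) \<longlonglongrightarrow> 0}"

sublocale vector_space "pw_scale :: 'f \<Rightarrow> _"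
  by (rule vector_space_pw_scale)

section \<open>The supremum norm and its space\<close>

lemma Q_nonempty: "Q \<noteq> {}"
  using Q_coord by blast

lemma Q_le_nrm: "bdd f \<Longrightarrow> q \<in> Q \<Longrightarrow> q f \<le> nrm f"
  by (auto simp: bdd_def nrm_def intro: cSUP_upper)

lemma bddI: "(\<And>q. q \<in> Q \<Longrightarrow> q f \<le> c) \<Longrightarrow> bdd f"
  by (auto simp: bdd_def bdd_above_def)

lemma nrm_leI: "(\<And>q. q \<in> Q \<Longrightarrow> q f \<le> c) \<Longrightarrow> nrm f \<le> c"
  unfolding nrm_def by (rule cSUP_least[OF Q_nonempty])

lemma bdd_add: "bdd f \<Longrightarrow> bdd g \<Longrightarrow> bdd (f + g)"
  by (rule bddI[where c = "nrm f + nrm g"]) (meson Q_add Q_le_nrm add_mono order_trans)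

lemma nrm_add: "bdd f \<Longrightarrow> bdd g \<Longrightarrow> nrm (f + g) \<le> nrm f + nrm g"
  by (rule nrm_leI) (meson Q_add Q_le_nrm add_mono order_trans)

lemma bdd_scale: "bdd f \<Longrightarrow> bdd (pw_scale c f)"
  by (rule bddI[where c = "norm c * nrm f"]) (simp add: Q_scale Q_le_nrm mult_left_mono)

lemma nrm_scale_le: "bdd f \<Longrightarrow> nrm (pw_scale c f) \<le> norm c * nrm f"
  by (rule nrm_leI) (simp add: Q_scale Q_le_nrm mult_left_mono)

lemma nrm_nonneg: "bdd f \<Longrightarrow> 0 \<le> nrm f"
  using Q_nonempty Q_nonneg Q_le_nrm by (meson all_not_in_conv order_trans)

lemma Q_zero: "q \<in> Q \<Longrightarrow> q 0 = 0"
  using Q_scale[of q 0 0] by (simp add: scale_zero_right)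

lemma bdd_zero: "bdd 0"
  by (rule bddI[where c = 0]) (simp add: Q_zero)

lemma nrm_zero: "nrm 0 = 0"
  using nrm_leI[of 0 0] nrm_nonneg[OF bdd_zero] by (simp add: Q_zero)

lemma nrm_scale: "bdd f \<Longrightarrow> nrm (pw_scale c f) = norm c * nrm f"
proof (cases "c = 0")
  case True
  then show ?thesis by (simp add: scale_zero_left nrm_zero)
next
  case False
  assume f: "bdd f"
  have "nrm f = nrm (pw_scale (inverse c) (pw_scale c f))"
    using False by (simp add: scale_scale scale_one)
  also have "\<dots> \<le> norm (inverse c) * nrm (pw_scale c f)"
    by (intro nrm_scale_le bdd_scale f)
  finally have "norm c * nrm f \<le> nrm (pw_scale c f)"
    using False by (simp add: norm_inverse norm_divide field_simps)
  then show ?thesis using nrm_scale_le[OF f, of c] by simp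
qed

lemma minus_eq: "- f = pw_scale (-1) (f :: nat \<Rightarrow> 'f)"
  by (simp add: pw_scale_def fun_eq_iff)

lemma bdd_uminus: "bdd f \<Longrightarrow> bdd (- f)"
  unfolding minus_eq by (rule bdd_scale)

lemma nrm_uminus: "bdd f \<Longrightarrow> nrm (- f) = nrm f"
  using nrm_scale[of f "-1"] unfolding minus_eq by (simp del: scale_minus_left)

lemma bdd_diff: "bdd f \<Longrightarrow> bdd g \<Longrightarrow> bdd (f - g)"
  using bdd_add[of f "- g"] bdd_uminus by simp

lemma nrm_diff: "bdd f \<Longrightarrow> bdd g \<Longrightarrow> nrm (f - g) \<le> nrm f + nrm g"
  using nrm_add[of f "- g"] bdd_uminus[of g] nrm_uminus[of g] by simp

lemma nrm_minus_commute: "bdd (f - g) \<Longrightarrow> nrm (f - g) = nrm (g - f)"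
  using nrm_uminus[of "f - g"] by simp

lemma bdd_trunc: "bdd f \<Longrightarrow> bdd (trunc m f)"
  by (rule bddI[where c = "nrm f"]) (rule Q_le_nrm[OF _ Q_trunc])

lemma nrm_trunc_le: "bdd f \<Longrightarrow> nrm (trunc m f) \<le> nrm f"
  by (rule nrm_leI) (rule Q_le_nrm[OF _ Q_trunc])

lemma coord_le: "bdd f \<Longrightarrow> norm (f n) \<le> nrm f"
  using Q_coord[of n] Q_le_nrm order_trans by blast

lemma bdd_unit: "bdd (unit_seq n)"
  using Q_unit bddI by metis

lemma X_bdd: "f \<in> X \<Longrightarrow> bdd f"
  by (simp add: X_def)

lemma X_I: "bdd f \<Longrightarrow> trunc k f = f \<Longrightarrow> f \<in> X"
proof -
  assume f: "bdd f" "trunc k f = f"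
  have "trunc m f = f" if "m \<ge> k" for m
    using trunc_trunc[of m k f] f that by (simp add: min_def split: if_splits)
  then have "\<forall>\<^sub>F m in sequentially. nrm (f - trunc m f) = 0"
    by (intro eventually_sequentiallyI[of k]) (simp add: nrm_zero)
  then show ?thesis
    using f by (simp add: X_def tendsto_eventually)
qed

lemma unit_in_X: "unit_seq n \<in> X"
  by (rule X_I[OF bdd_unit, of "Suc n"]) (auto simp: unit_seq_def trunc_def)

lemma trunc_pw_scale: "trunc m (pw_scale c f) = pw_scale c (trunc m (f :: nat \<Rightarrow> 'f))"
  by (auto simp: trunc_def pw_scale_def)

lemma trunc_add: "trunc m (f + g) = trunc m f + trunc m (g :: nat \<Rightarrow> 'f)"
  by (auto simp: trunc_def fun_eq_iff)

lemma subspace_X: "subspace X"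
proof (rule subspaceI)
  show "0 \<in> X" by (rule X_I[OF bdd_zero, of 0]) (auto simp: trunc_def)
next
  fix f g assume fg: "f \<in> X" "g \<in> X"
  then have b: "bdd f" "bdd g" by (auto simp: X_def)
  have lim: "(\<lambda>m. nrm (f - trunc m f) + nrm (g - trunc m g)) \<longlonglongrightarrow> 0 + 0"
    using fg by (intro tendsto_add) (auto simp: X_def)
  have "nrm (f + g - trunc m (f + g)) \<le> nrm (f - trunc m f) + nrm (g - trunc m g)" for m
    using nrm_add[of "f - trunc m f" "g - trunc m g"] b
    by (simp add: bdd_diff bdd_trunc trunc_add algebra_simps)
  moreover have "0 \<le> nrm (f + g - trunc m (f + g))" for m
    using b by (intro nrm_nonneg bdd_diff bdd_trunc bdd_add)
  ultimately have "(\<lambda>m. nrm (f + g - trunc m (f + g))) \<longlonglongrightarrow> 0"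
    using lim by (intro tendsto_sandwich[OF _ _ tendsto_const lim[simplified]]) auto
  then show "f + g \<in> X" using b by (simp add: X_def bdd_add)
next
  fix c f assume f: "f \<in> X"
  have "nrm (pw_scale c f - trunc m (pw_scale c f)) = norm c * nrm (f - trunc m f)" for m
    using f nrm_scale[of "f - trunc m f" c]
    by (simp add: trunc_pw_scale scale_right_diff_distrib bdd_diff bdd_trunc X_bdd)
  moreover have "(\<lambda>m. norm c * nrm (f - trunc m f)) \<longlonglongrightarrow> norm c * 0"
    using f by (intro tendsto_mult_left) (simp add: X_def)
  ultimately show "pw_scale c f \<in> X" using f by (simp add: X_def bdd_scale)
qed

text \<open>The limit is taken coordinatewise. Each single seminorm passes to the limit with a bound
  independent of the seminorm, so convergence holds in the supremum norm.\<close>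

lemma X_complete:
  assumes u: "\<And>n. u n \<in> X" and Cauchy_u: "\<forall>e>0. \<exists>N. \<forall>m\<ge>N. \<forall>n\<ge>N. nrm (u m - u n) < e"
  shows "\<exists>l\<in>X. (\<lambda>n. nrm (u n - l)) \<longlonglongrightarrow> 0"
proof -
  have bu: "bdd (u n)" for n using u by (rule X_bdd)
  have "Cauchy (\<lambda>n. u n i)" for i
  proof (rule CauchyI)
    fix e :: real assume "0 < e"
    then obtain N where "\<forall>m\<ge>N. \<forall>n\<ge>N. nrm (u m - u n) < e" using Cauchy_u by blast
    moreover have "norm (u m i - u n i) \<le> nrm (u m - u n)" for m n
      using coord_le[of "u m - u n" i] bu by (simp add: bdd_diff)
    ultimately show "\<exists>N. \<forall>m\<ge>N. \<forall>n\<ge>N. norm (u m i - u n i) < e" by (meson le_less_trans)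
  qed
  then have "\<exists>L. (\<lambda>n. u n i) \<longlonglongrightarrow> L" for i
    using Cauchy_convergent_iff convergent_def by blast
  then obtain l where l: "\<And>i. (\<lambda>n. u n i) \<longlonglongrightarrow> l i" by metis
  have close: "\<exists>N. \<forall>n\<ge>N. bdd (u n - l) \<and> nrm (u n - l) \<le> e" if e: "0 < e" for e
  proof -
    obtain N where N: "\<And>m n. m \<ge> N \<Longrightarrow> n \<ge> N \<Longrightarrow> nrm (u m - u n) < e" using Cauchy_u e by blast
    have "q (u n - l) \<le> e" if "n \<ge> N" "q \<in> Q" for n q
    proof (rule tendsto_upperbound)
      show "(\<lambda>m. q (u n - u m)) \<longlonglongrightarrow> q (u n - l)"
        using that l by (intro Q_tendsto) (auto intro!: tendsto_intros)
      show "\<forall>\<^sub>F m in sequentially. q (u n - u m) \<le> e"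
      proof (rule eventually_sequentiallyI[of N])
        fix m assume "N \<le> m"
        then show "q (u n - u m) \<le> e"
          using N[of n m] Q_le_nrm[of "u n - u m" q] bu that by (simp add: bdd_diff)
      qed
    qed simp
    then show ?thesis by (metis bddI nrm_leI)
  qed
  have "bdd l"
  proof -
    obtain n where "bdd (u n - l)" using close[of 1] by auto
    then show ?thesis using bdd_diff[OF bu[of n], of "u n - l"] by simp
  qed
  moreover have "(\<lambda>m. nrm (l - trunc m l)) \<longlonglongrightarrow> 0"
  proof (rule LIMSEQ_I)
    fix e :: real assume e: "0 < e"
    obtain n where n: "bdd (u n - l)" "nrm (u n - l) \<le> e / 3"
      using close[of "e / 3"] e by auto
    have "(\<lambda>m. nrm (u n - trunc m (u n))) \<longlonglongrightarrow> 0" using u by (simp add: X_def)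
    from LIMSEQ_D[OF this, of "e / 3"] e
    obtain M where M: "\<And>m. m \<ge> M \<Longrightarrow> \<bar>nrm (u n - trunc m (u n))\<bar> < e / 3" by auto
    have "nrm (l - trunc m l) < e" if "m \<ge> M" for m
    proof -
      \<comment> \<open>The tail of \<open>l\<close> is the tail of one fixed approximant minus the
        tail of the error \<open>u n - l\<close>. The latter is at most 2e/3 for every
        \<open>m\<close>, because truncations are contractions.\<close>
      have "l - trunc m l = (u n - trunc m (u n)) - ((u n - l) - trunc m (u n - l))"
        by (simp add: trunc_diff)
      then have "nrm (l - trunc m l)
          \<le> nrm (u n - trunc m (u n)) + nrm ((u n - l) - trunc m (u n - l))"
        using bu n by (metis nrm_diff bdd_diff bdd_trunc)
      also have "nrm ((u n - l) - trunc m (u n - l)) \<le> nrm (u n - l) + nrm (trunc m (u n - l))"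
        using n by (intro nrm_diff bdd_trunc)
      also have "\<dots> \<le> e / 3 + e / 3" using n nrm_trunc_le[OF n(1), of m] by simp
      finally show ?thesis using M[OF that] by linarith
    qed
    then show "\<exists>M. \<forall>m\<ge>M. norm (nrm (l - trunc m l) - 0) < e"
      using nrm_nonneg[OF bdd_diff[OF \<open>bdd l\<close> bdd_trunc[OF \<open>bdd l\<close>]]] by auto
  qed
  moreover have "(\<lambda>n. nrm (u n - l)) \<longlonglongrightarrow> 0"
  proof (rule LIMSEQ_I)
    fix e :: real assume e: "0 < e"
    obtain N where N: "\<And>n. n \<ge> N \<Longrightarrow> bdd (u n - l) \<and> nrm (u n - l) \<le> e / 2"
      using close[of "e / 2"] e by auto
    then have "norm (nrm (u n - l) - 0) < e" if "n \<ge> N" for n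
      using N[OF that] nrm_nonneg[of "u n - l"] e by simp
    then show "\<exists>N. \<forall>n\<ge>N. norm (nrm (u n - l) - 0) < e" by blast
  qed
  ultimately show ?thesis unfolding X_def by blast
qed

section \<open>The unit vectors as a monotone Schauder basis\<close>

lemma trunc_in_span: "trunc m f \<in> span (range unit_seq)"
proof -
  have "(\<Sum>n<m. pw_scale (f n) (unit_seq n)) \<in> span (range unit_seq)"
    by (intro span_sum span_scale span_base) simp
  then show ?thesis by (simp add: sum_unit_seq trunc_eq_restr)
qed

sublocale basis: banach_basis pw_scale X nrm unit_seq "\<lambda>n f. f n"
proof unfold_locales
  show "subspace X" by (rule subspace_X)
  show "f \<in> X \<Longrightarrow> 0 \<le> nrm f" for f by (simp add: X_bdd nrm_nonneg)
  show "nrm f = 0 \<longleftrightarrow> f = 0" if "f \<in> X" for f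
  proof
    assume "nrm f = 0"
    then show "f = 0" using coord_le[OF X_bdd[OF that]] by (auto simp: fun_eq_iff)
  qed (simp add: nrm_zero)
  show "f \<in> X \<Longrightarrow> nrm (pw_scale c f) = norm c * nrm f" for c f by (simp add: X_bdd nrm_scale)
  show "f \<in> X \<Longrightarrow> g \<in> X \<Longrightarrow> nrm (f + g) \<le> nrm f + nrm g" for f g
    by (simp add: X_bdd nrm_add)
  show "(\<And>n. u n \<in> X) \<Longrightarrow> \<forall>e>0. \<exists>N. \<forall>m\<ge>N. \<forall>n\<ge>N. nrm (u m - u n) < e \<Longrightarrow>
      \<exists>l\<in>X. (\<lambda>n. nrm (u n - l)) \<longlonglongrightarrow> 0" for u by (rule X_complete)
  show "unit_seq n \<in> X" for n by (rule unit_in_X)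
  show "\<exists>C. \<forall>n. nrm (unit_seq n) \<le> C" using Q_unit nrm_leI by metis
  show "\<exists>g\<in>span (range unit_seq). nrm (f - g) < e" if "f \<in> X" "0 < e" for f and e :: real
  proof -
    have "(\<lambda>m. nrm (f - trunc m f)) \<longlonglongrightarrow> 0" using that by (simp add: X_def)
    from LIMSEQ_D[OF this that(2)] obtain m where "\<bar>nrm (f - trunc m f)\<bar> < e" by auto
    then show ?thesis using trunc_in_span by (metis abs_less_iff)
  qed
  have "\<forall>n. \<forall>f\<in>X. norm (f n) \<le> 1 * nrm f" by (auto intro: coord_le X_bdd)
  then show "\<exists>C. \<forall>n. \<forall>f\<in>X. norm (f n) \<le> C * nrm f" by blast
qed (auto simp: pw_scale_def unit_seq_def)

lemma restr_in_X: "finite A \<Longrightarrow> restr A f \<in> X"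
  using subspace_sum[OF subspace_X, of A "\<lambda>n. pw_scale (f n) (unit_seq n)"]
  by (simp add: sum_unit_seq subspace_scale subspace_X unit_in_X)

text \<open>Partial sums are truncations, so existence is the tail condition in \<open>X\<close>.
  Uniqueness follows from continuity of coordinates: the n-th coordinate of a partial sum is
  constant once m > n.\<close>

lemma schauder_basis: "basis.schauder_basis unit_seq"
  unfolding basis.schauder_basis_def
proof (intro conjI allI ballI)
  show "unit_seq n \<in> X" for n by (rule unit_in_X)
next
  fix f assume f: "f \<in> X"
  have sum_eq: "(\<Sum>n<m. pw_scale (a n) (unit_seq n)) = trunc m a" for m and a :: "nat \<Rightarrow> 'f"
    by (simp add: sum_unit_seq trunc_eq_restr)
  show "\<exists>!a. (\<lambda>m. nrm ((\<Sum>n<m. pw_scale (a n) (unit_seq n)) - f)) \<longlonglongrightarrow> 0"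
    unfolding sum_eq
  proof (rule ex1I[of _ f])
    have "nrm (trunc m f - f) = nrm (f - trunc m f)" for m
      using f by (intro nrm_minus_commute bdd_diff bdd_trunc X_bdd)
    then show "(\<lambda>m. nrm (trunc m f - f)) \<longlonglongrightarrow> 0" using f by (simp add: X_def)
  next
    fix a assume a: "(\<lambda>m. nrm (trunc m a - f)) \<longlonglongrightarrow> 0"
    show "a = f"
    proof
      fix n
      have "norm (a n - f n) \<le> nrm (trunc m a - f)" if "m \<ge> Suc n" for m
      proof -
        have "bdd (trunc m a - f)"
          using f by (simp add: bdd_diff X_bdd restr_in_X trunc_eq_restr)
        from coord_le[OF this, of n] show ?thesis using that by (simp add: trunc_def)
      qed
      then have "norm (a n - f n) \<le> 0"
        by (intro tendsto_lowerbound[OF a]) (auto intro!: eventually_sequentiallyI[of "Suc n"])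
      then show "a n = f n" by simp
    qed
  qed
qed

lemma S_eq_restr: "finite A \<Longrightarrow> basis.S A f = restr A f"
  by (simp add: basis.S_def sum_unit_seq)

lemma signed_sum_eq_restr: "finite A \<Longrightarrow> basis.signed_sum \<epsilon> A = restr A \<epsilon>"
  by (simp add: basis.signed_sum_def sum_unit_seq)

lemma monotone_basis: "basis.monotone_basis"
proof -
  have op: "basis.operator_norm (basis.S {..<m}) =
      (SUP f\<in>{f \<in> X. nrm f \<le> 1}. ennreal (nrm (trunc m f)))" for m
    by (simp add: basis.operator_norm_def S_eq_restr trunc_eq_restr)
  have "basis.operator_norm (basis.S {..<m}) \<le> 1" for m
    unfolding op
  proof (rule SUP_least, clarify)
    fix f assume "f \<in> X" "nrm f \<le> 1"
    then have "nrm (trunc m f) \<le> 1" using nrm_trunc_le[OF X_bdd, of f m] by simp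
    then show "ennreal (nrm (trunc m f)) \<le> 1" by (simp add: ennreal_le_1)
  qed
  moreover have "1 \<le> basis.operator_norm (basis.S {..<1})"
  proof -
    define e where "e = (unit_seq 0 :: nat \<Rightarrow> 'f)"
    have e0: "nrm e > 0" using coord_le[OF bdd_unit[of 0], of 0] by (simp add: e_def unit_seq_def)
    \<comment> \<open>The vector \<open>unit_seq 0\<close> need not have norm 1, so a normalised
      multiple serves as the fixed vector of \<open>trunc 1\<close>.\<close>
    define f where "f = pw_scale (of_real (inverse (nrm e))) e"
    have "f \<in> X" "nrm f = 1" "trunc 1 f = f"
    proof -
      show "f \<in> X" unfolding f_def e_def by (intro subspace_scale subspace_X unit_in_X)
      have "norm (of_real (inverse (nrm e)) :: 'f) = inverse (nrm e)"
        using e0 by (simp del: of_real_inverse)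
      then show "nrm f = 1" using e0 unfolding f_def by (simp add: nrm_scale bdd_unit e_def)
      show "trunc 1 f = f" by (auto simp: f_def e_def trunc_def pw_scale_def unit_seq_def fun_eq_iff)
    qed
    then show ?thesis unfolding op
      by (intro SUP_upper2[of f]) auto
  qed
  ultimately show ?thesis
    unfolding basis.monotone_basis_def
    by (intro antisym SUP_least) (auto intro: SUP_upper2[of 1])
qed

end

section \<open>Dyadic blocks and a Schreier family\<close>

definition block :: "nat \<Rightarrow> nat set" where
  "block n = {2 ^ n<..<2 ^ Suc n}"

text \<open>For \<open>n = 0\<close> the block is empty and the defect is \<open>f 1\<close>. Index
  0 enters no defect at all.\<close>

definition defect :: "real \<Rightarrow> nat \<Rightarrow> (nat \<Rightarrow> 'f::real_normed_field) \<Rightarrow> 'f" where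
  "defect t n f = f (2 ^ n) - of_real ((2 ^ n - 1) powr (t - 1)) * (\<Sum>i\<in>block n. f i)"

text \<open>With t = 1/p < 1, the supremum over all finite \<open>F\<close> is an equivalent norm on
  weak l_p that satisfies the triangle inequality; for t = 1 it is the l_1 norm.\<close>

definition weak_avg :: "real \<Rightarrow> nat set \<Rightarrow> (nat \<Rightarrow> 'f::real_normed_field) \<Rightarrow> real" where
  "weak_avg t F h = real (card F) powr (t - 1) * (\<Sum>n\<in>F. norm (h n))"

text \<open>The size bound is of Schreier type. The summand 1 in \<open>2 * i + 1\<close> makes
  \<open>{0}\<close> admissible, so that coordinate 0 is controlled too. Powers of two are excluded
  so that the large coefficients of \<open>test_seq\<close> stay invisible to this part of the
  norm.\<close>

definition admissible :: "nat set \<Rightarrow> bool" where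
  "admissible F \<longleftrightarrow> finite F \<and> F \<inter> range ((^) 2) = {} \<and> (\<forall>i\<in>F. card F \<le> 2 * i + 1)"

text \<open>Precomposition with every \<open>trunc m\<close> closes the family under truncation, as
  \<open>Q_trunc\<close> demands.\<close>

definition seminorms :: "real \<Rightarrow> ((nat \<Rightarrow> 'f::real_normed_field) \<Rightarrow> real) set" where
  "seminorms t = {\<lambda>f. weak_avg t F (\<lambda>n. defect t n (trunc m f)) | m F. finite F} \<union>
     {\<lambda>f. weak_avg t F (trunc m f) | m F. admissible F}"

lemma defect_seminorm:
  "finite F \<Longrightarrow> (\<lambda>f. weak_avg t F (\<lambda>n. defect t n (trunc m f))) \<in> seminorms t"
  unfolding seminorms_def by blast

lemma admissible_seminorm:
  "admissible F \<Longrightarrow> (\<lambda>f. weak_avg t F (trunc m f)) \<in> seminorms t"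
  unfolding seminorms_def by blast

lemma finite_block [simp]: "finite (block n)"
  by (simp add: block_def)

lemma card_block: "real (card (block n)) = 2 ^ n - 1"
proof -
  have "Suc (card (block n)) = 2 ^ n"
    by (simp add: block_def Suc_diff_Suc)
  then have "real (Suc (card (block n))) = 2 ^ n" by simp
  then show ?thesis by simp
qed

lemma floor_log_block: "i \<in> block n \<Longrightarrow> floor_log i = n"
  by (rule floor_log_eqI) (auto simp: block_def)

lemma weak_avg_nonneg: "0 \<le> weak_avg t F h"
  by (simp add: weak_avg_def sum_nonneg)

lemma weak_avg_scale: "weak_avg t F (\<lambda>n. c * h n) = norm c * weak_avg t F h"
  by (simp add: weak_avg_def norm_mult sum_distrib_left[symmetric] mult.left_commute)

lemma weak_avg_add: "weak_avg t F (\<lambda>n. h n + k n) \<le> weak_avg t F h + weak_avg t F k"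
  unfolding weak_avg_def distrib_left[symmetric] sum.distrib[symmetric]
  by (intro mult_left_mono sum_mono norm_triangle_ineq) simp

lemma weak_avg_tendsto:
  "(\<And>i. (\<lambda>k. u k i) \<longlonglongrightarrow> l i) \<Longrightarrow> (\<lambda>k. weak_avg t F (u k)) \<longlonglongrightarrow> weak_avg t F l"
  unfolding weak_avg_def by (intro tendsto_intros) auto

lemma defect_scale: "defect t n (pw_scale c f) = c * defect t n f"
  by (simp add: defect_def pw_scale_def sum_distrib_left[symmetric] algebra_simps)

lemma defect_add: "defect t n (f + g) = defect t n f + defect t n g"
  by (simp add: defect_def sum.distrib algebra_simps)

lemma defect_tendsto:
  "(\<And>i. (\<lambda>k. u k i) \<longlonglongrightarrow> l i) \<Longrightarrow> (\<lambda>k. defect t n (u k)) \<longlonglongrightarrow> defect t n l"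
  unfolding defect_def by (intro tendsto_intros) auto

lemma trunc_tendsto:
  "(\<And>i. (\<lambda>k. u k i) \<longlonglongrightarrow> l i) \<Longrightarrow> (\<lambda>k. trunc m (u k) i) \<longlonglongrightarrow> trunc m l i"
  by (auto simp: trunc_def)

section \<open>Inequalities for powers with exponent at most 1\<close>

lemma powr_minus_one_mult: "x powr (t - 1) * x = x powr t" if "0 \<le> x" for x t :: real
proof (cases "x = 0")
  case False
  then show ?thesis using that powr_add[of x "t - 1" 1] by simp
qed simp

lemma powr_antimono: "x powr a \<le> y powr a" if "0 < y" "y \<le> x" "a \<le> 0" for x y a :: real
  using powr_mono2'[of a y x] that by simp

text \<open>A weakened form of the tangent inequality at \<open>r\<close> for the concave function
  x^t: the first summand alone suffices for x <= r, the second for x > r.\<close>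

lemma powr_le_tangent:
  assumes "0 < r" "0 \<le> x" "0 \<le> t" "t \<le> (1::real)"
  shows "x powr t \<le> r powr t + r powr (t - 1) * x"
proof (cases "x \<le> r")
  case True
  then have "x powr t \<le> r powr t" using assms by (intro powr_mono2) auto
  then show ?thesis using assms by (simp add: add_increasing2)
next
  case False
  then have "x powr t = x powr (t - 1) * x" using assms by (simp add: powr_minus_one_mult)
  also have "\<dots> \<le> r powr (t - 1) * x"
    using assms False by (intro mult_right_mono powr_antimono) auto
  finally show ?thesis by (simp add: add_increasing)
qed

text \<open>Jensen's inequality for x^t, with a factor 2 lost to the weakened tangent bound. It
  passes from the sizes of the dyadic pieces of a set to the size of the set.\<close>

lemma sum_powr_le:
  fixes x :: "nat \<Rightarrow> real"
  assumes t: "0 < t" "t \<le> 1" and F: "finite F" and x: "\<And>n. n \<in> F \<Longrightarrow> 0 \<le> x n"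
    and s: "(\<Sum>n\<in>F. x n) \<le> s"
  shows "real (card F) powr (t - 1) * (\<Sum>n\<in>F. x n powr t) \<le> 2 * s powr t"
proof -
  have s0: "0 \<le> s" using sum_nonneg[of F x] x s by force
  consider "F = {}" | "s = 0" | "F \<noteq> {}" "0 < s" using s0 by linarith
  then show ?thesis
  proof cases
    case 2
    then have "(\<Sum>n\<in>F. x n) = 0" using s sum_nonneg[of F x] x by force
    then have "\<forall>n\<in>F. x n = 0" using sum_nonneg_eq_0_iff[OF F, of x] x by simp
    then show ?thesis by simp
  next
    case 3
    \<comment> \<open>The tangent point is \<open>s / N\<close>, an upper bound for the mean of the
      \<open>x n\<close>; there both terms of the tangent bound sum to at most
      \<open>N * r powr t\<close>.\<close>
    define N r where "N = real (card F)" and "r = s / N"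
    have N: "0 < N" using 3 F by (simp add: N_def card_gt_0_iff)
    then have r: "0 < r" and s_eq: "s = N * r" using 3 by (simp_all add: r_def)
    have "(\<Sum>n\<in>F. x n powr t) \<le> (\<Sum>n\<in>F. r powr t + r powr (t - 1) * x n)"
      using t r x by (intro sum_mono powr_le_tangent) auto
    also have "\<dots> = N * r powr t + r powr (t - 1) * (\<Sum>n\<in>F. x n)"
      by (simp add: sum.distrib sum_distrib_left N_def)
    also have "\<dots> \<le> N * r powr t + r powr (t - 1) * s"
      by (intro add_left_mono mult_left_mono s) simp
    also have "\<dots> = N * (2 * r powr t)"
      using powr_minus_one_mult[of r t] r by (simp add: s_eq algebra_simps)
    finally have "N powr (t - 1) * (\<Sum>n\<in>F. x n powr t) \<le> (N powr (t - 1) * N) * (2 * r powr t)"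
      by (simp add: mult.assoc mult_left_mono)
    also have "\<dots> = 2 * s powr t"
      using N r by (simp add: powr_minus_one_mult s_eq powr_mult)
    finally show ?thesis by (simp add: N_def)
  qed simp
qed

section \<open>Upper estimate for coefficients of modulus at most 1\<close>

lemma sum_norm_flat_le:
  assumes "finite E" "finite B" "\<And>i. norm (f i) \<le> 1" "\<And>i. i \<notin> E \<Longrightarrow> f i = 0"
  shows "(\<Sum>i\<in>B. norm (f i)) \<le> real (card (E \<inter> B))"
proof -
  have "(\<Sum>i\<in>B. norm (f i)) = (\<Sum>i\<in>E \<inter> B. norm (f i))"
    using assms by (intro sum.mono_neutral_right) auto
  also have "\<dots> \<le> (\<Sum>i\<in>E \<inter> B. 1)" using assms by (intro sum_mono)
  finally show ?thesis by simp
qed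

text \<open>Each of the two terms of the defect is at most card^t. For the block sum with c nonzero
  coordinates allowed, c <= K and t - 1 <= 0 give K^(t-1) c <= c^t.\<close>

lemma norm_defect_flat_le:
  assumes t: "0 < t" "t \<le> 1" and E: "finite E"
    and f: "\<And>i. norm (f i) \<le> 1" "\<And>i. i \<notin> E \<Longrightarrow> f i = 0"
  shows "norm (defect t n f) \<le> 2 * real (card (E \<inter> {2 ^ n..<2 ^ Suc n})) powr t"
proof -
  let ?D = "E \<inter> {2 ^ n..<2 ^ Suc n}" and ?c = "real (card (E \<inter> block n))"
  have first: "norm (f (2 ^ n)) \<le> real (card ?D) powr t"
  proof (cases "2 ^ n \<in> E")
    case True
    then have "2 ^ n \<in> ?D" by simp
    then have "card ?D > 0" using E by (auto simp: card_gt_0_iff)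
    then have "1 \<le> real (card ?D) powr t" using t by (intro ge_one_powr_ge_zero) auto
    then show ?thesis using f(1)[of "2 ^ n"] by linarith
  qed (simp add: f)
  have c_le: "?c \<le> real (card ?D)"
    using E by (auto simp: block_def intro!: card_mono)
  have "norm (\<Sum>i\<in>block n. f i) \<le> ?c"
    by (rule order_trans[OF norm_sum sum_norm_flat_le]) (use E f in auto)
  then have "norm (of_real ((2 ^ n - 1) powr (t - 1)) * (\<Sum>i\<in>block n. f i))
      \<le> (2 ^ n - 1) powr (t - 1) * ?c"
    by (simp add: norm_mult mult_left_mono)
  also have "\<dots> \<le> ?c powr t"
  proof (cases "?c = 0")
    case False
    have "?c \<le> 2 ^ n - 1"
      unfolding card_block[symmetric] by (simp add: card_mono)
    then have "(2 ^ n - 1) powr (t - 1) * ?c \<le> ?c powr (t - 1) * ?c"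
      using False t by (intro mult_right_mono powr_antimono) auto
    then show ?thesis by (simp add: powr_minus_one_mult)
  qed simp
  also have "\<dots> \<le> real (card ?D) powr t"
    using t c_le by (intro powr_mono2) auto
  finally show ?thesis
    using first norm_triangle_ineq4[of "f (2 ^ n)"
        "of_real ((2 ^ n - 1) powr (t - 1)) * (\<Sum>i\<in>block n. f i)"]
    by (simp add: defect_def)
qed

lemma dyadic_disjoint:
  "i \<in> {2 ^ n..<2 ^ Suc n} \<Longrightarrow> i \<in> {2 ^ k..<2 ^ Suc k} \<Longrightarrow> n = (k::nat)" for i :: nat
  using floor_log_eqI[of i n] floor_log_eqI[of i k] by (cases "i = 0") auto

lemma seminorm_flat_le:
  assumes t: "0 < t" "t \<le> 1" and E: "finite E" and q: "q \<in> seminorms t"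
    and f: "\<And>i. norm (f i) \<le> 1" "\<And>i. i \<notin> E \<Longrightarrow> f i = 0"
  shows "q f \<le> 4 * real (card E) powr t"
proof -
  have tf: "norm (trunc m f i) \<le> 1" "i \<notin> E \<Longrightarrow> trunc m f i = 0" for m i
    using f by (auto simp: trunc_def)
  from q consider
    m F where "finite F" "q = (\<lambda>f. weak_avg t F (\<lambda>n. defect t n (trunc m f)))" |
    m F where "admissible F" "q = (\<lambda>f. weak_avg t F (trunc m f))"
    by (auto simp: seminorms_def)
  then show ?thesis
  proof cases
    case 1
    \<comment> \<open>The dyadic pieces of \<open>E\<close> are disjoint, so their sizes add up to
      at most \<open>card E\<close>, as \<open>sum_powr_le\<close> requires.\<close>
    define D where "D n = E \<inter> {2 ^ n..<2 ^ Suc n}" for n :: nat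
    have "D n \<inter> D k = {}" if "n \<noteq> k" for n k
      using that dyadic_disjoint unfolding D_def by blast
    then have "card (\<Union>n\<in>F. D n) = (\<Sum>n\<in>F. card (D n))"
      using 1 E by (intro card_UN_disjoint) (auto simp: D_def)
    then have "(\<Sum>n\<in>F. real (card (D n))) = real (card (\<Union>n\<in>F. D n))" by simp
    also have "\<dots> \<le> real (card E)"
      using E by (auto simp: D_def intro!: card_mono)
    finally have *: "(\<Sum>n\<in>F. real (card (D n))) \<le> real (card E)" .
    have "q f \<le> real (card F) powr (t - 1) * (\<Sum>n\<in>F. 2 * real (card (D n)) powr t)"
      unfolding 1 weak_avg_def D_def
      by (intro mult_left_mono sum_mono norm_defect_flat_le t E tf) auto
    also have "\<dots> = 2 * (real (card F) powr (t - 1) * (\<Sum>n\<in>F. real (card (D n)) powr t))"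
      by (simp add: sum_distrib_left[symmetric])
    also have "\<dots> \<le> 2 * (2 * real (card E) powr t)"
      using 1 by (intro mult_left_mono sum_powr_le t *) auto
    finally show ?thesis by simp
  next
    case 2
    then have F: "finite F" by (simp add: admissible_def)
    let ?c = "real (card (E \<inter> F))"
    have "q f \<le> real (card F) powr (t - 1) * ?c"
      unfolding 2 weak_avg_def using F E tf by (intro mult_left_mono sum_norm_flat_le) auto
    \<comment> \<open>Shrinking \<open>F\<close> to its part inside \<open>E\<close> only increases
      the weight, since the exponent is not positive.\<close>
    also have "\<dots> \<le> ?c powr (t - 1) * ?c"
    proof (cases "?c = 0")
      case False
      then show ?thesis using F t
        by (intro mult_right_mono powr_antimono) (auto intro!: card_mono)
    qed simp
    also have "\<dots> \<le> real (card E) powr t"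
      using E t by (auto simp: powr_minus_one_mult intro!: powr_mono2 card_mono)
    finally show ?thesis by (simp add: mult_ge1_I order_trans[OF _ mult_right_mono[of 1 4]])
  qed
qed

text \<open>If \<open>n\<close> is a power of two, truncation right after \<open>n\<close> deletes
  the block sum and the defect is \<open>f n\<close>. Otherwise \<open>{n}\<close> is
  admissible.\<close>

lemma seminorm_coord:
  fixes n :: nat
  shows "\<exists>q\<in>seminorms t. \<forall>f :: nat \<Rightarrow> 'f::real_normed_field. norm (f n) \<le> q f"
proof (cases "n \<in> range ((^) 2)")
  case True
  then obtain k where k: "n = 2 ^ k" by auto
  let ?q = "\<lambda>f :: nat \<Rightarrow> 'f. weak_avg t {k} (\<lambda>j. defect t j (trunc (Suc n) f))"
  have "?q \<in> seminorms t" by (rule defect_seminorm) simp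
  moreover have "norm (f n) \<le> ?q f" for f
    by (auto simp: weak_avg_def defect_def trunc_def k block_def intro!: sum.neutral)
  ultimately show ?thesis by (intro bexI[of _ ?q] allI)
next
  case False
  let ?q = "\<lambda>f :: nat \<Rightarrow> 'f. weak_avg t {n} (trunc (Suc n) f)"
  have "admissible {n}" using False by (auto simp: admissible_def)
  then have "?q \<in> seminorms t" by (rule admissible_seminorm)
  moreover have "norm (f n) \<le> ?q f" for f by (simp add: weak_avg_def trunc_def)
  ultimately show ?thesis by (intro bexI[of _ ?q] allI)
qed

lemma seminorm_family_seminorms:
  assumes t: "0 < t" "t \<le> 1"
  shows "seminorm_family (seminorms t :: ((nat \<Rightarrow> 'f::{real_normed_field,banach}) \<Rightarrow> real) set)"
proof
  fix q :: "(nat \<Rightarrow> 'f) \<Rightarrow> real" assume q: "q \<in> seminorms t"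
  show "0 \<le> q f" for f using q by (auto simp: seminorms_def weak_avg_nonneg)
  have tr: "trunc m (pw_scale c f) = pw_scale c (trunc m f)"
    "trunc m (f + g) = trunc m f + trunc m g" for m and c :: 'f and f g :: "nat \<Rightarrow> 'f"
    by (auto simp: trunc_def pw_scale_def fun_eq_iff)
  show "q (pw_scale c f) = norm c * q f" for c f
    using q by (auto simp: seminorms_def tr defect_scale weak_avg_scale)
      (simp add: pw_scale_def weak_avg_scale)
  show "q (f + g) \<le> q f + q g" for f g
    using q by (auto simp: seminorms_def tr defect_add weak_avg_add)
      (simp add: plus_fun_def weak_avg_add)
  show "(\<lambda>k. q (u k)) \<longlonglongrightarrow> q l" if "\<And>i. (\<lambda>k. u k i) \<longlonglongrightarrow> l i" for u l
    using q that
    by (auto simp: seminorms_def intro!: weak_avg_tendsto defect_tendsto trunc_tendsto)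
  show "(\<lambda>f. q (trunc m f)) \<in> seminorms t" for m
    using q unfolding seminorms_def by (auto simp: trunc_trunc)
next
  show "\<exists>C. \<forall>q\<in>seminorms t. \<forall>n. q (unit_seq n :: nat \<Rightarrow> 'f) \<le> C"
  proof (intro exI[of _ 4] ballI allI)
    fix q :: "(nat \<Rightarrow> 'f) \<Rightarrow> real" and n assume q: "q \<in> seminorms t"
    have "q (unit_seq n :: nat \<Rightarrow> 'f) \<le> 4 * real (card {n}) powr t"
      by (rule seminorm_flat_le[OF t _ q]) (auto simp: unit_seq_def)
    then show "q (unit_seq n :: nat \<Rightarrow> 'f) \<le> 4" by simp
  qed
qed (rule seminorm_coord)

section \<open>Lower estimate for coefficients of modulus at least 1\<close>

lemma weak_avg_ge:
  assumes "finite F" "\<And>n. n \<in> F \<Longrightarrow> 1 \<le> norm (h n)"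
  shows "real (card F) powr t \<le> weak_avg t F h"
proof -
  have "real (card F) powr t = real (card F) powr (t - 1) * (\<Sum>n\<in>F. 1)"
    by (simp add: powr_minus_one_mult)
  also have "\<dots> \<le> weak_avg t F h"
    unfolding weak_avg_def using assms by (intro mult_left_mono sum_mono) auto
  finally show ?thesis .
qed

lemma powr_sixth_le: "(x::real) powr t / 6 \<le> y powr t"
  if "0 < t" "t \<le> 1" "0 \<le> x" "x \<le> 6 * y" for x y t :: real
proof -
  have "x powr t \<le> (6 * y) powr t" using that by (intro powr_mono2) auto
  also have "\<dots> = 6 powr t * y powr t" using that by (simp add: powr_mult)
  also have "\<dots> \<le> 6 powr 1 * y powr t"
    using that by (intro mult_right_mono powr_mono) auto
  finally show ?thesis by simp
qed

text \<open>Either a proportion of \<open>A\<close> lies off the powers of two, where the larger half of it is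
  admissible, or for most powers of two in \<open>A\<close> the set \<open>A\<close> misses the corresponding block.\<close>

lemma seminorm_flat_ge:
  fixes a :: "nat \<Rightarrow> 'f::real_normed_field"
  assumes t: "0 < t" "t \<le> 1" and A: "finite A" and a: "\<And>i. i \<in> A \<Longrightarrow> 1 \<le> norm (a i)"
  shows "\<exists>q\<in>seminorms t. real (card A) powr t / 6 \<le> q (restr A a)"
proof -
  obtain m where m: "A \<subseteq> {..<m}" using A finite_nat_iff_bounded by blast
  then have tr: "trunc m (restr A a) = restr A a"
    by (auto simp: trunc_def restr_def fun_eq_iff)
  define B where "B = A - range ((^) 2)"
  define D where "D = {n. 2 ^ n \<in> A}"
  have fB: "finite B" and BA: "B \<subseteq> A" using A by (auto simp: B_def)
  have A_split: "A = B \<union> (^) 2 ` D" by (auto simp: B_def D_def)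
  have inj2: "inj_on ((^) (2::nat)) D" by (auto simp: inj_on_def)
  have fD: "finite D" using finite_imageD[OF _ inj2] A A_split by (metis finite_Un)
  have card_A: "card A \<le> card B + card D"
    using card_Un_le[of B "(^) 2 ` D"] card_image[OF inj2] A_split by simp
  show ?thesis
  proof (cases "card A \<le> 3 * card B")
    case True
    \<comment> \<open>The discarded elements of \<open>B\<close> lie below
      \<open>card B div 2\<close>, so at least half of \<open>B\<close> remains and
      \<open>card A \<le> 3 * card B \<le> 6 * card F\<close>.\<close>
    define F where "F = {i \<in> B. card B \<le> 2 * i + 1}"
    have "B \<subseteq> F \<union> {i. 2 * i + 1 < card B}" by (auto simp: F_def)
    moreover have "{i. 2 * i + 1 < card B} = {..<card B div 2}" by auto
    ultimately have "card B \<le> card (F \<union> {..<card B div 2})"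
      using fB by (intro card_mono) (auto simp: F_def)
    also have "\<dots> \<le> card F + card B div 2" using card_Un_le[of F "{..<card B div 2}"] by simp
    finally have "card A \<le> 6 * card F" using True by linarith
    moreover have "admissible F"
    proof -
      have "card F \<le> card B" using fB by (intro card_mono) (auto simp: F_def)
      moreover have "finite F" using fB by (simp add: F_def)
      ultimately show ?thesis unfolding admissible_def by (auto simp: F_def B_def)
    qed
    moreover have "real (card F) powr t \<le> weak_avg t F (trunc m (restr A a))"
      unfolding tr using fB BA a by (intro weak_avg_ge) (auto simp: F_def restr_def)
    ultimately have "real (card A) powr t / 6 \<le> weak_avg t F (trunc m (restr A a))"
      using powr_sixth_le[OF t, of "card A" "card F"] by linarith
    then show ?thesis by (rule bexI[OF _ admissible_seminorm[OF \<open>admissible F\<close>]])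
  next
    case False
    \<comment> \<open>For these exponents \<open>A\<close> contains \<open>2 ^ n\<close> and misses
      the block, so nothing cancels in the defect. At most \<open>card B\<close> exponents are lost,
      hence card F >= card A - 2 card B > card A / 3.\<close>
    define F where "F = D - floor_log ` B"
    have fF: "finite F" using fD by (simp add: F_def)
    have "card D - card (floor_log ` B) \<le> card F"
      unfolding F_def using fB by (intro diff_card_le_card_Diff) simp
    then have "card A \<le> 6 * card F"
      using False card_A card_image_le[OF fB, of floor_log] by linarith
    moreover have "defect t n (restr A a) = a (2 ^ n)" if "n \<in> F" for n
    proof -
      have "restr A a i = 0" if i: "i \<in> block n" for i
      proof -
        have "i \<notin> range ((^) 2)"
          using i floor_log_block[OF i] by (auto simp: block_def)
        moreover have "i \<notin> B" using floor_log_block[OF i] \<open>n \<in> F\<close> by (auto simp: F_def)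
        ultimately show ?thesis by (simp add: B_def restr_def)
      qed
      then show ?thesis using that by (simp add: defect_def restr_def F_def D_def)
    qed
    then have "real (card F) powr t \<le> weak_avg t F (\<lambda>n. defect t n (trunc m (restr A a)))"
      unfolding tr using fF a by (intro weak_avg_ge) (auto simp: F_def D_def)
    ultimately have "real (card A) powr t / 6
        \<le> weak_avg t F (\<lambda>n. defect t n (trunc m (restr A a)))"
      using powr_sixth_le[OF t, of "card A" "card F"] by linarith
    then show ?thesis by (rule bexI[OF _ defect_seminorm[OF fF]])
  qed
qed

section \<open>The failure of QGLC\<close>

text \<open>On the \<open>n\<close>-th block the defect vanishes because
  \<open>K powr (t - 1) * K * K powr -t = 1\<close> for \<open>K = 2 ^ n - 1\<close>.\<close>

definition test_seq :: "real \<Rightarrow> nat \<Rightarrow> nat \<Rightarrow> 'f::real_normed_field" where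
  "test_seq t N i = (let n = floor_log i in
     if 1 \<le> n \<and> n \<le> N then if i = 2 ^ n then 1 else of_real ((2 ^ n - 1) powr - t) else 0)"

lemma test_seq_power: "test_seq t N (2 ^ n) = (if 1 \<le> n \<and> n \<le> N then 1 else 0)"
  by (simp add: test_seq_def)

lemma test_seq_block:
  "i \<in> block n \<Longrightarrow>
    test_seq t N i = (if 1 \<le> n \<and> n \<le> N then of_real ((2 ^ n - 1) powr - t) else 0)"
  by (auto simp: test_seq_def floor_log_block Let_def) (auto simp: block_def)

text \<open>This makes the powers of two, where the value is 1, a greedy set.\<close>

lemma norm_test_seq_le: "norm (test_seq t N i :: 'f::real_normed_field) \<le> 1" if "0 < t"
proof -
  have "(2 ^ n - 1 :: real) powr - t \<le> 1" if "1 \<le> n" for n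
  proof -
    have "(1::real) \<le> 2 ^ n - 1" using that power_increasing[of 1 n "2::real"] by simp
    then show ?thesis using \<open>0 < t\<close> powr_antimono[of 1 "2 ^ n - 1" "- t"] by simp
  qed
  then show ?thesis by (simp add: test_seq_def Let_def)
qed

text \<open>A block wholly before the cut \<open>m\<close> has cancelling terms, and one wholly
  after it contributes nothing. In a block that is cut after c of its K coordinates, the defect is 1
  - c/K.\<close>

lemma norm_defect_test_seq_le:
  assumes t: "0 < t" "t \<le> 1"
  shows "norm (defect t n (trunc m (test_seq t N :: nat \<Rightarrow> 'f::real_normed_field)))
    \<le> (if 2 ^ n < m \<and> m < 2 ^ Suc n then 1 else 0)"
proof (cases "1 \<le> n \<and> n \<le> N")
  case False
  then have "(\<Sum>i\<in>block n. trunc m (test_seq t N) i) = (0::'f)"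
    by (intro sum.neutral) (auto simp: trunc_def test_seq_block)
  then show ?thesis using False by (auto simp: defect_def trunc_def test_seq_power)
next
  case True
  define K :: real where "K = 2 ^ n - 1"
  define c where "c = real (card (block n \<inter> {..<m}))"
  have K: "1 \<le> K" using True power_increasing[of 1 n "2::real"] by (simp add: K_def)
  have c: "0 \<le> c" "c \<le> K"
    unfolding c_def K_def card_block[symmetric] by (auto intro!: card_mono)
  have "(\<Sum>i\<in>block n. trunc m (test_seq t N) i)
      = (\<Sum>i\<in>block n \<inter> {..<m}. of_real (K powr - t) :: 'f)"
    using True by (intro sum.mono_neutral_cong_right) (auto simp: trunc_def test_seq_block K_def)
  then have sum_eq: "(\<Sum>i\<in>block n. trunc m (test_seq t N) i) = (of_real (c * K powr - t) :: 'f)"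
    by (simp add: c_def)
  have "K powr (t - 1) * (c * K powr - t) = c * (K powr (t - 1) * K powr - t)" by simp
  also have "K powr (t - 1) * K powr - t = inverse K"
    using K by (simp only: powr_add[symmetric]) (simp add: powr_minus)
  finally have coef: "K powr (t - 1) * (c * K powr - t) = c / K" by (simp add: field_simps)
  have "trunc m (test_seq t N) (2 ^ n) = (of_real (if 2 ^ n < m then 1 else 0) :: 'f)"
    using True by (simp add: trunc_def test_seq_power)
  then have "defect t n (trunc m (test_seq t N))
      = (of_real ((if 2 ^ n < m then 1 else 0) - K powr (t - 1) * (c * K powr - t)) :: 'f)"
    unfolding defect_def K_def[symmetric] sum_eq by simp
  then have norm_eq: "norm (defect t n (trunc m (test_seq t N)) :: 'f)
      = \<bar>(if 2 ^ n < m then 1 else 0) - c / K\<bar>"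
    by (simp only: coef norm_of_real)
  consider "m \<le> 2 ^ n" | "2 ^ n < m" "m < 2 ^ Suc n" | "2 ^ Suc n \<le> m" by linarith
  then show ?thesis
  proof cases
    case 1
    then have "c = 0" by (auto simp: c_def block_def)
    then show ?thesis using norm_eq 1 by simp
  next
    case 2
    have "0 \<le> c / K" "c / K \<le> 1" using c K by (auto simp: field_simps)
    then show ?thesis using norm_eq 2 by simp
  next
    case 3
    then have "block n \<inter> {..<m} = block n" by (auto simp: block_def)
    then have "c = K" by (simp add: c_def card_block K_def)
    moreover have "2 ^ n < m" using 3 by (intro less_le_trans[OF _ 3]) simp
    ultimately show ?thesis using norm_eq K 3 by simp
  qed
qed

text \<open>On the n-th block with n >= 1 one has i < 2^(n+1), hence i/4 < 2^n / 2 <= 2^n - 1 =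
  K.\<close>

lemma norm_test_seq_decay:
  assumes t: "0 < t" and i: "i \<notin> range ((^) 2)" "0 < i"
  shows "norm (test_seq t N i :: 'f::real_normed_field) \<le> (real i / 4) powr - t"
proof (cases "1 \<le> floor_log i \<and> floor_log i \<le> N")
  case True
  define n where "n = floor_log i"
  have "2 ^ 1 \<le> (2::real) ^ n" using True by (intro power_increasing) (auto simp: n_def)
  moreover have "i < 2 * 2 ^ n"
    using floor_log_exp2_gt[of i] by (simp add: n_def)
  then have "real i < 2 * 2 ^ n" by (metis of_nat_less_iff of_nat_mult of_nat_numeral of_nat_power)
  ultimately have "real i / 4 \<le> 2 ^ n - 1" by simp
  then have "(2 ^ n - 1) powr - t \<le> (real i / 4) powr - t"
    using t i by (intro powr_antimono) auto
  then show ?thesis using True i by (auto simp: test_seq_def n_def[symmetric] Let_def)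
next
  case False
  then show ?thesis by (auto simp: test_seq_def Let_def)
qed

text \<open>The point is independence of \<open>N\<close>. The defect part sees at most one cut
  block. In the Schreier part the coordinates decay like i^(-t), while the size of an admissible set
  is bounded by a multiple of its least positive index.\<close>

lemma seminorm_test_seq_le:
  assumes t: "0 < t" "t \<le> 1" and q: "q \<in> seminorms t"
  shows "q (test_seq t N :: nat \<Rightarrow> 'f::real_normed_field) \<le> 12"
proof -
  from q consider
    m F where "finite F" "q = (\<lambda>f. weak_avg t F (\<lambda>n. defect t n (trunc m f)))" |
    m F where "admissible F" "q = (\<lambda>f. weak_avg t F (trunc m f))"
    by (auto simp: seminorms_def)
  then show ?thesis
  proof cases
    case 1
    let ?G = "{n \<in> F. 2 ^ n < m \<and> m < 2 ^ Suc n}"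
    \<comment> \<open>The cut \<open>m\<close> lies strictly inside at most one dyadic
      interval.\<close>
    have "\<forall>n\<in>?G. \<forall>k\<in>?G. n = k" using dyadic_disjoint[of m] by fastforce
    then have "card ?G \<le> 1" using \<open>finite F\<close> card_le_Suc0_iff_eq[of ?G] by simp
    have "(\<Sum>n\<in>F. norm (defect t n (trunc m (test_seq t N :: nat \<Rightarrow> 'f))))
        \<le> (\<Sum>n\<in>F. if 2 ^ n < m \<and> m < 2 ^ Suc n then 1 else 0)"
      by (intro sum_mono norm_defect_test_seq_le t)
    also have "\<dots> = real (card ?G)" using \<open>finite F\<close> by (simp add: sum.If_cases Int_def)
    also have "\<dots> \<le> 1" using \<open>card ?G \<le> 1\<close> by simp
    finally have *: "(\<Sum>n\<in>F. norm (defect t n (trunc m (test_seq t N :: nat \<Rightarrow> 'f)))) \<le> 1" .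
    have "real (card F) powr (t - 1) \<le> 1"
    proof (cases "card F = 0")
      case False
      then show ?thesis using t powr_antimono[of 1 "card F" "t - 1"] by simp
    qed simp
    then have "q (test_seq t N) \<le> 1 * 1"
      unfolding 1 weak_avg_def using * by (intro mult_mono) (auto intro: sum_nonneg)
    then show ?thesis by simp
  next
    case 2
    then have F: "finite F" by (simp add: admissible_def)
    let ?c = "real (card F)"
    have "norm (trunc m (test_seq t N) i :: 'f) \<le> (?c / 12) powr - t" if "i \<in> F" for i
    proof (cases "i = 0")
      case True
      then show ?thesis by (simp add: trunc_def test_seq_def)
    next
      case False
      have "card F \<le> 2 * i + 1" and np: "i \<notin> range ((^) 2)"
        using 2 that by (auto simp: admissible_def)
      \<comment> \<open>For i >= 1 admissibility gives card F <= 2i + 1 <= 3i; with the 4 from the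
        decay estimate this yields 12.\<close>
      then have "?c / 12 \<le> real i / 4" using False by simp
      moreover have "0 < ?c" using that F by (auto simp: card_gt_0_iff)
      ultimately have "(real i / 4) powr - t \<le> (?c / 12) powr - t"
        using t by (intro powr_antimono) auto
      then show ?thesis using norm_test_seq_decay[OF t(1) np, of N, where 'f = 'f] False
        by (auto simp: trunc_def)
    qed
    then have "(\<Sum>i\<in>F. norm (trunc m (test_seq t N) i :: 'f)) \<le> ?c * (?c / 12) powr - t"
      by (rule sum_bounded_above)
    then have "q (test_seq t N) \<le> ?c powr (t - 1) * (?c * (?c / 12) powr - t)"
      unfolding 2 weak_avg_def by (intro mult_left_mono) auto
    also have "\<dots> = ?c powr t * (?c / 12) powr - t"
      by (simp add: powr_minus_one_mult flip: mult.assoc)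
    also have "\<dots> \<le> 12 powr t"
      by (cases "card F = 0") (auto simp: powr_divide powr_minus field_simps)
    also have "\<dots> \<le> 12 powr 1" using t by (intro powr_mono) auto
    finally show ?thesis by simp
  qed
qed

section \<open>Consequences of the two-sided estimates and construction of the basis\<close>

context seminorm_family
begin

text \<open>By homogeneity the infimum of the |a_n| may be scaled to 1. Then both sums are compared
  with \<open>card A powr t\<close>.\<close>

lemma LPU_I:
  assumes "0 \<le> c'" and c: "0 < c" and t: "0 < t"
    and le: "\<And>A f. finite A \<Longrightarrow> (\<And>i. i \<in> A \<Longrightarrow> norm (f i) \<le> 1) \<Longrightarrow>
      nrm (restr A f) \<le> c' * real (card A) powr t"
    and ge: "\<And>A f. finite A \<Longrightarrow> (\<And>i. i \<in> A \<Longrightarrow> 1 \<le> norm (f i)) \<Longrightarrow>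
      c * real (card A) powr t \<le> nrm (restr A f)"
  shows "basis.LPU"
  unfolding basis.LPU_def
proof (intro exI[of _ "c' / c"] allI impI)
  fix A and a b :: "nat \<Rightarrow> 'f"
  assume A: "finite A" "A \<noteq> {}" and ba: "(SUP n\<in>A. norm (b n)) \<le> (INF n\<in>A. norm (a n))"
  define r where "r = (INF n\<in>A. norm (a n))"
  have b: "norm (b n) \<le> r" if "n \<in> A" for n
    using ba A that unfolding r_def by (meson bdd_above_finite cSUP_upper finite_imageI order_trans)
  have a: "r \<le> norm (a n)" if "n \<in> A" for n
    using A that unfolding r_def by (intro cINF_lower) auto
  have "nrm (restr A b) \<le> c' / c * nrm (restr A a)"
  \<comment> \<open>Division by \<open>r\<close> is impossible here, but then all \<open>b n\<close>
    vanish on \<open>A\<close>.\<close>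
  proof (cases "r \<le> 0")
    case True
    have "b n = 0" if "n \<in> A" for n
      using b[OF that] True norm_ge_zero[of "b n"] by (metis norm_le_zero_iff order_trans)
    then have "restr A b = 0" by (auto simp: restr_def fun_eq_iff)
    moreover have "0 \<le> nrm (restr A a)" using A by (intro nrm_nonneg X_bdd restr_in_X)
    ultimately show ?thesis using assms by (simp add: nrm_zero)
  next
    case False
    have split: "restr A f = pw_scale (of_real r) (restr A (\<lambda>i. f i / of_real r))"
      for f :: "nat \<Rightarrow> 'f"
      using False by (auto simp: restr_def pw_scale_def)
    have nrm_split: "nrm (restr A f) = r * nrm (restr A (\<lambda>i. f i / of_real r))"
      for f :: "nat \<Rightarrow> 'f"
      using A False by (subst split) (simp add: nrm_scale X_bdd restr_in_X)
    have "nrm (restr A (\<lambda>i. b i / of_real r)) \<le> c' * real (card A) powr t"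
      using A b False by (intro le) (auto simp: norm_divide field_simps)
    also have "\<dots> = c' / c * (c * real (card A) powr t)" using c by simp
    also have "\<dots> \<le> c' / c * nrm (restr A (\<lambda>i. a i / of_real r))"
      using A a False assms(1) c by (intro mult_left_mono ge) (auto simp: norm_divide field_simps)
    finally have "r * nrm (restr A (\<lambda>i. b i / of_real r))
        \<le> r * (c' / c * nrm (restr A (\<lambda>i. a i / of_real r)))"
      using False by (intro mult_left_mono) auto
    then show ?thesis unfolding nrm_split[of b] nrm_split[of a] by (simp only: mult.left_commute)
  qed
  then show "nrm (\<Sum>n\<in>A. pw_scale (b n) (unit_seq n))
      \<le> c' / c * nrm (\<Sum>n\<in>A. pw_scale (a n) (unit_seq n))"
    using A by (simp add: sum_unit_seq)
qed

end

text \<open>Stated over a general complete scalar field, so that the real and the complex case are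
  both instances.\<close>

lemma exists_basis:
  fixes t :: real
  assumes t: "0 < t" "t \<le> 1"
  shows "\<exists>(scale :: 'f::{real_normed_field,banach} \<Rightarrow> (nat \<Rightarrow> 'f) \<Rightarrow> (nat \<Rightarrow> 'f)) X nrm x xs.
        banach_basis scale X nrm x xs \<and>
        banach_space_on.schauder_basis scale X nrm x \<and>
        banach_basis.monotone_basis scale X nrm x xs \<and>
        banach_basis.LUCC scale nrm x \<and>
        banach_basis.super_democratic scale nrm x \<and>
        banach_basis.LPU scale nrm x \<and>
        \<not> banach_basis.QGLC scale X nrm x xs \<and>
        (\<exists>C\<ge>1. \<forall>m\<ge>1.
           inverse C * real m powr t \<le> banach_basis.fundamental_function scale nrm x m \<and>
           banach_basis.fundamental_function scale nrm x m \<le> C * real m powr t)"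
proof -
  interpret seminorm_family "seminorms t :: ((nat \<Rightarrow> 'f) \<Rightarrow> real) set"
    by (rule seminorm_family_seminorms[OF t])
  have le: "nrm (restr A f) \<le> 4 * real (card A) powr t"
    if "finite A" "\<And>i. i \<in> A \<Longrightarrow> norm (f i) \<le> 1" for A f
    using that by (intro nrm_leI seminorm_flat_le[OF t]) (auto simp: restr_def)
  have ge: "1 / 6 * real (card A) powr t \<le> nrm (restr A f)"
    if A: "finite A" and f: "\<And>i. i \<in> A \<Longrightarrow> 1 \<le> norm (f i)" for A and f :: "nat \<Rightarrow> 'f"
  proof -
    obtain q where "q \<in> seminorms t" "real (card A) powr t / 6 \<le> q (restr A f)"
      using seminorm_flat_ge[OF t A, of f] f by blast
    then show ?thesis using Q_le_nrm[OF X_bdd[OF restr_in_X[OF A]], of q f] by simp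
  qed
  \<comment> \<open>Here 24 = 4 * 6, from the upper and lower estimates. LUCC is the case of equal
    sets; super-democracy uses sets of different sizes.\<close>
  have compare: "nrm (restr A f) \<le> 24 * nrm (restr B g)"
    if "finite A" "finite B" "card A \<le> card B" "\<And>i. i \<in> A \<Longrightarrow> norm (f i) \<le> 1"
      "\<And>i. i \<in> B \<Longrightarrow> 1 \<le> norm (g i)" for A B and f g :: "nat \<Rightarrow> 'f"
  proof -
    have "real (card A) powr t \<le> real (card B) powr t"
      using that t by (intro powr_mono2) auto
    moreover have "nrm (restr A f) \<le> 4 * real (card A) powr t" using that by (intro le)
    moreover have "1 / 6 * real (card B) powr t \<le> nrm (restr B g)" using that by (intro ge)
    ultimately show ?thesis by linarith
  qed
  have "basis.LUCC"
    unfolding basis.LUCC_def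
  proof (intro exI[of _ 24] allI impI)
    fix A and a b :: "nat \<Rightarrow> 'f"
    assume A: "finite A"
      and ab: "\<forall>n\<in>A. norm (b n) = 1 \<and> (\<exists>s::real. 1 \<le> s \<and> a n / b n = of_real s)"
    have "1 \<le> norm (a n)" if n: "n \<in> A" for n
    proof -
      obtain s :: real where "1 \<le> s" "a n / b n = of_real s" "norm (b n) = 1" using ab n by blast
      then have "norm (a n) = \<bar>s\<bar>" by (metis div_by_1 norm_divide norm_of_real)
      then show ?thesis using \<open>1 \<le> s\<close> by simp
    qed
    then show "nrm (\<Sum>n\<in>A. pw_scale (b n) (unit_seq n))
        \<le> 24 * nrm (\<Sum>n\<in>A. pw_scale (a n) (unit_seq n))"
      using compare[of A A b a] A ab by (simp add: sum_unit_seq)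
  qed
  moreover have "basis.super_democratic"
    unfolding basis.super_democratic_def
    by (intro exI[of _ 24] allI impI) (simp add: signed_sum_eq_restr compare)
  moreover have "basis.LPU"
    by (rule LPU_I[of 4 "1 / 6" t]) (use t le ge in auto)
  moreover have "\<not> basis.QGLC"
  proof
    assume "basis.QGLC"
    then obtain C where C: "\<And>f A. f \<in> X \<Longrightarrow> A \<noteq> {} \<Longrightarrow> basis.greedy_set f A \<Longrightarrow>
        basis.osc f A = 1 \<Longrightarrow> nrm (basis.S A f) \<le> C * nrm f"
      unfolding basis.QGLC_def by blast
    \<comment> \<open>The projection onto \<open>A\<close> has norm at least N^t / 6 while
      \<open>f\<close> has norm at most 12, whence 72 = 6 * 12.\<close>
    have bound: "real N powr t \<le> 72 * \<bar>C\<bar>" if N: "1 \<le> N" for N :: nat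
    proof -
      define f :: "nat \<Rightarrow> 'f" where "f = test_seq t N"
      define A :: "nat set" where "A = (^) 2 ` {1..N}"
      have A: "finite A" "A \<noteq> {}" "card A = N"
        using N by (auto simp: A_def card_image inj_on_def)
      have f_A: "f n = 1" if "n \<in> A" for n
        using that by (auto simp: A_def f_def test_seq_power)
      have "f = restr {..<2 ^ Suc N} f"
      proof
        fix i
        have "2 ^ Suc N \<le> i \<Longrightarrow> Suc N \<le> floor_log i" by (metis floor_log_le_iff floor_log_power)
        then show "f i = restr {..<2 ^ Suc N} f i"
          by (auto simp: restr_def f_def test_seq_def Let_def not_less)
      qed
      then have "f \<in> X" by (metis finite_lessThan restr_in_X)
      \<comment> \<open>At index 3, where K = 1, the coefficient is also 1; greedy sets allow such
        ties.\<close>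
      moreover have "basis.greedy_set f A"
        using A f_A norm_test_seq_le[OF t(1), of N, where 'f = 'f]
        by (simp add: basis.greedy_set_def f_def)
      moreover have "basis.osc f A = 1"
      proof -
        have "(\<lambda>n. norm (f n)) ` A = {1}" using A f_A by force
        then show ?thesis by (simp add: basis.osc_def)
      qed
      ultimately have "nrm (restr A f) \<le> C * nrm f"
        using C[of f A] A by (simp add: S_eq_restr)
      \<comment> \<open>The constant \<open>C\<close> is not assumed nonnegative, hence the absolute
        value.\<close>
      also have "\<dots> \<le> \<bar>C\<bar> * 12"
        using nrm_nonneg[OF X_bdd[OF \<open>f \<in> X\<close>]] unfolding f_def
        by (intro mult_mono nrm_leI seminorm_test_seq_le t) auto
      finally show ?thesis using ge[of A f] A f_A by simp
    qed
    obtain N :: nat where N: "(72 * \<bar>C\<bar> + 1) powr (1 / t) \<le> real N"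
      using real_arch_simple by blast
    moreover have "0 < (72 * \<bar>C\<bar> + 1) powr (1 / t)" by (simp add: add_nonneg_pos)
    ultimately have "1 \<le> N" by (cases N) auto
    have "72 * \<bar>C\<bar> + 1 = ((72 * \<bar>C\<bar> + 1) powr (1 / t)) powr t"
      using t by (simp add: powr_powr add_nonneg_nonneg)
    also have "\<dots> \<le> real N powr t" using N t by (intro powr_mono2) auto
    finally show False using bound[OF \<open>1 \<le> N\<close>] by simp
  qed
  moreover have "\<exists>C\<ge>1. \<forall>m\<ge>1.
      inverse C * real m powr t \<le> basis.fundamental_function m \<and>
      basis.fundamental_function m \<le> C * real m powr t"
  \<comment> \<open>The lower estimate needs 6, and this also covers the constant 4 of the upper
    one.\<close>
  proof (intro exI[of _ 6] conjI allI impI)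
    fix m :: nat
    let ?M = "{nrm (basis.signed_sum \<epsilon> A) | A \<epsilon>.
      finite A \<and> card A \<le> m \<and> (\<forall>n\<in>A. norm (\<epsilon> n) = 1)}"
    have M: "nrm (basis.signed_sum (\<lambda>_. 1) {..<m}) \<in> ?M" by force
    have "inverse 6 * real m powr t \<le> nrm (basis.signed_sum (\<lambda>_. 1) {..<m})"
      using ge[of "{..<m}" "\<lambda>_. 1"] by (simp add: signed_sum_eq_restr)
    also have "\<dots> \<le> basis.fundamental_function m"
      unfolding basis.fundamental_function_def
      by (rule cSup_upper[OF M basis.fundamental_function_bdd_above])
    finally show "inverse 6 * real m powr t \<le> basis.fundamental_function m" .
    show "basis.fundamental_function m \<le> 6 * real m powr t"
      unfolding basis.fundamental_function_def
    proof (rule cSup_least)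
      show "?M \<noteq> {}" using M by blast
    next
      fix s assume "s \<in> ?M"
      then obtain A \<epsilon> where A: "finite A" "card A \<le> m" "\<forall>n\<in>A. norm (\<epsilon> n) = 1"
        and s: "s = nrm (basis.signed_sum \<epsilon> A)" by blast
      have "s \<le> 4 * real (card A) powr t" using A le[of A \<epsilon>] by (simp add: s signed_sum_eq_restr)
      moreover have "real (card A) powr t \<le> real m powr t"
        using A t by (intro powr_mono2) auto
      ultimately show "s \<le> 6 * real m powr t" using powr_ge_zero[of m t] by linarith
    qed
  qed simp
  ultimately show ?thesis
    using basis.banach_basis_axioms schauder_basis monotone_basis by blast
qed

theorem theorem4p4:
  shows "\<forall>p::real. 1 \<le> p \<longrightarrow>
    (\<exists>(scale :: real \<Rightarrow> (nat \<Rightarrow> real) \<Rightarrow> (nat \<Rightarrow> real)) X nrm x xs.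
        banach_basis scale X nrm x xs \<and>
        banach_space_on.schauder_basis scale X nrm x \<and>
        banach_basis.monotone_basis scale X nrm x xs \<and>
        banach_basis.LUCC scale nrm x \<and>
        banach_basis.super_democratic scale nrm x \<and>
        banach_basis.LPU scale nrm x \<and>
        \<not> banach_basis.QGLC scale X nrm x xs \<and>
        (\<exists>C\<ge>1. \<forall>m\<ge>1.
           inverse C * real m powr (1 / p) \<le> banach_basis.fundamental_function scale nrm x m \<and>
           banach_basis.fundamental_function scale nrm x m \<le> C * real m powr (1 / p))) \<and>
    (\<exists>(scale :: complex \<Rightarrow> (nat \<Rightarrow> complex) \<Rightarrow> (nat \<Rightarrow> complex)) X nrm x xs.
        banach_basis scale X nrm x xs \<and>
        banach_space_on.schauder_basis scale X nrm x \<and>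
        banach_basis.monotone_basis scale X nrm x xs \<and>
        banach_basis.LUCC scale nrm x \<and>
        banach_basis.super_democratic scale nrm x \<and>
        banach_basis.LPU scale nrm x \<and>
        \<not> banach_basis.QGLC scale X nrm x xs \<and>
        (\<exists>C\<ge>1. \<forall>m\<ge>1.
           inverse C * real m powr (1 / p) \<le> banach_basis.fundamental_function scale nrm x m \<and>
           banach_basis.fundamental_function scale nrm x m \<le> C * real m powr (1 / p)))"
  \<comment> \<open>The exponent is t = 1/p, which lies in (0, 1].\<close>
  by (intro allI impI conjI exists_basis) auto

end
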